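(* Let $\mathcal A$ be a totally ordered finite alphabet with $|\mathcal A|>1$ and let $a=\min(\mathcal A)$. An $\mathcal A$-strict episturmian word $\mathbf t$ is an infinite Lyndon word if and only if $\mathbf t=a\mathbf s$ where $\mathbf s$ is an (aperiodic) $\mathcal A$-strict epistandard word. Moreover, if $\Delta=x_1x_2\cdots$ is the directive word of $\mathbf s$, then $\mathbf t=a\mathbf s$ is the unique episturmian word having the same set of factors as $\mathbf s$ that is directed by the spinned version of $\Delta$ in which every letter has spin $R$ except the letters $x_i=a$, which have spin $L$.
   Context: For $c\in\mathcal A$, $L_c,R_c$ are the morphisms with $L_c(c)=R_c(c)=c$, $L_c(d)=cd$, $R_c(d)=dc$ ($d\ne c$). Spinned words are words over $\mathcal A\cup\{\bar x:x\in\mathcal A\}$ (unbarred letters spin $L$, barred spin $R$); a spinned version of $x_1x_2\cdots$ is $\breve x_1\breve x_2\cdots$ with $\breve x_i\in\{x_i,\bar x_i\}$; $\mu_c=L_c$, $\mu_{\bar c}=R_c$. An infinite word is episturmian if its set of factors is closed under reversal and it has at most one right special factor of each length. A spinned infinite word $\breve x_1\breve x_2\cdots$ directs $\mathbf t$ if there are recurrent infinite words $\mathbf t^{(n)}$ with $\mathbf t^{(0)}=\mathbf t$, $\mathbf t^{(n-1)}=\mu_{\breve x_n}(\mathbf t^{(n)})$. $Pal$: $Pal(\varepsilon)=\varepsilon$, $Pal(ux)$ the shortest palindrome with prefix $Pal(u)x$; an epistandard word is $\mathbf s=\lim_nPal(x_1\cdots x_n)$ for $\Delta=x_1x_2\cdots\in\mathcal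 A^\omega$ (its directive word). An epistandard word $\mathbf s$, or any episturmian word with the same set of factors as $\mathbf s$, is $\mathcal A$-strict if every letter of $\mathcal A$ occurs infinitely often in $\Delta$. An infinite Lyndon word is an infinite word strictly lexicographically smaller than all its proper suffixes. *)

theory Defs
  imports "HOL-Library.Omega_Words_Fun" "HOL-Library.Cardinality"
begin

text \<open>
  The alphabet is the whole (finite, linearly ordered) type \<open>'a\<close>. Infinite words are functions
  from \<open>nat\<close>, so the letter \<open>x\<^sub>n\<close> of \<open>x\<^sub>1x\<^sub>2\<dots>\<close> is the value at \<open>n - 1\<close>.
\<close>

definition factors :: "'a word \<Rightarrow> 'a list set" where
  "factors w = {w [i \<rightarrow> j] | i j. i \<le> j}"

definition recurrent :: "'a word \<Rightarrow> bool" where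
  "recurrent w \<longleftrightarrow> (\<forall>u \<in> factors w. infinite {i. w [i \<rightarrow> i + length u] = u})"

definition aperiodic :: "'a word \<Rightarrow> bool" where
  "aperiodic w \<longleftrightarrow> \<not> (\<exists>u v. v \<noteq> [] \<and> w = u \<frown> v\<^sup>\<omega>)"

definition right_special :: "'a word \<Rightarrow> 'a list \<Rightarrow> bool" where
  "right_special w u \<longleftrightarrow>
     (\<exists>x y. x \<noteq> y \<and> u @ [x] \<in> factors w \<and> u @ [y] \<in> factors w)"

definition episturmian :: "'a word \<Rightarrow> bool" where
  "episturmian w \<longleftrightarrow>
     (\<forall>u \<in> factors w. rev u \<in> factors w) \<and>
     (\<forall>u v. right_special w u \<and> right_special w v \<and> length u = length v \<longrightarrow> u = v)"

definition lex_less :: "'a::linorder word \<Rightarrow> 'a word \<Rightarrow> bool" where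
  "lex_less u v \<longleftrightarrow> (\<exists>n. (\<forall>i<n. u i = v i) \<and> u n < v n)"

definition infinite_Lyndon :: "'a::linorder word \<Rightarrow> bool" where
  "infinite_Lyndon w \<longleftrightarrow> (\<forall>k>0. lex_less w (suffix k w))"

definition L_mor :: "'a \<Rightarrow> 'a \<Rightarrow> 'a list" where
  "L_mor c d = (if d = c then [c] else [c, d])"

definition R_mor :: "'a \<Rightarrow> 'a \<Rightarrow> 'a list" where
  "R_mor c d = (if d = c then [c] else [d, c])"

text \<open>
  Image of an infinite word under the morphism with letter images \<open>f\<close>. This is correct when
  \<open>f\<close> is non-erasing: the image of the prefix of length \<open>n + 1\<close> then has more than \<open>n\<close> letters.
\<close>

definition morph_image :: "('a \<Rightarrow> 'b list) \<Rightarrow> 'a word \<Rightarrow> 'b word" where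
  "morph_image f w = (\<lambda>n. concat (map f (prefix (Suc n) w)) ! n)"

text \<open>\<open>Plain x\<close> is the letter \<open>x\<close> with spin \<open>L\<close>, \<open>Barred x\<close> is the barred letter, with spin \<open>R\<close>.\<close>

datatype 'a spinned = Plain 'a | Barred 'a

fun mu :: "'a spinned \<Rightarrow> 'a \<Rightarrow> 'a list" where
  "mu (Plain c) = L_mor c"
| "mu (Barred c) = R_mor c"

definition directs :: "'a spinned word \<Rightarrow> 'a word \<Rightarrow> bool" where
  "directs b t \<longleftrightarrow>
     (\<exists>T :: nat \<Rightarrow> 'a word. T 0 = t \<and> (\<forall>n. recurrent (T n)) \<and>
        (\<forall>n. T n = morph_image (mu (b n)) (T (Suc n))))"

text \<open>
  The minimiser is unique: the shortest palindrome with prefix \<open>v\<close> is \<open>x @ y @ rev x\<close>, where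
  \<open>v = x @ y\<close> and \<open>y\<close> is the longest palindromic suffix of \<open>v\<close>.
\<close>

definition pal_closure :: "'a list \<Rightarrow> 'a list" where
  "pal_closure v = (ARG_MIN length p. rev p = p \<and> (\<exists>z. p = v @ z))"

definition Pal :: "'a list \<Rightarrow> 'a list" where
  "Pal u = foldl (\<lambda>p x. pal_closure (p @ [x])) [] u"

lemma Pal_Nil: "Pal [] = []"
  by (simp add: Pal_def)

lemma Pal_snoc: "Pal (u @ [x]) = pal_closure (Pal u @ [x])"
  by (simp add: Pal_def)

definition word_limit :: "(nat \<Rightarrow> 'a list) \<Rightarrow> 'a word \<Rightarrow> bool" where
  "word_limit u w \<longleftrightarrow> (\<forall>k. \<forall>\<^sub>\<infinity>n. take k (u n) = prefix k w)"

definition directive_word_of :: "'a word \<Rightarrow> 'a word \<Rightarrow> bool" where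
  "directive_word_of \<Delta> s \<longleftrightarrow> word_limit (\<lambda>n. Pal (prefix n \<Delta>)) s"

definition strict_epistandard :: "'a word \<Rightarrow> bool" where
  "strict_epistandard s \<longleftrightarrow>
     (\<exists>\<Delta>. directive_word_of \<Delta> s \<and> (\<forall>x. \<exists>\<^sub>\<infinity>i. \<Delta> i = x))"

definition strict_episturmian :: "'a word \<Rightarrow> bool" where
  "strict_episturmian t \<longleftrightarrow>
     episturmian t \<and> (\<exists>s. strict_epistandard s \<and> factors t = factors s)"

end

theory Submission
  imports Defs
begin

text \<open>
  Justin's formula \<open>Pal(xu) = L\<^sub>x(Pal u) x = x R\<^sub>x(Pal u)\<close> shows that the left special factors of
  \<open>Pal w\<close> are prefixes of it, so an epistandard word \<open>s\<close> is episturmian, and that \<open>s\<close> is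
  the \<open>L\<close>-image of the epistandard word of the shifted directive word. If every letter occurs
  infinitely often in \<open>\<Delta>\<close>, then \<open>c s\<close> has the factors of \<open>s\<close> for every letter \<open>c\<close>. If \<open>a s\<close> and a
  word \<open>t\<close> with the same factors first differ in \<open>a w x\<close> versus \<open>a w y\<close>, then \<open>w\<close> is a palindrome and
  both \<open>a w\<close> and \<open>x w\<close> are right special, so \<open>x = a\<close>. Hence \<open>a s\<close> is lexicographically least among
  these words, and aperiodicity makes it the only Lyndon one. Since \<open>L\<^sub>a(a w) = a L\<^sub>a(w)\<close> and
  \<open>R\<^sub>x(a w) = a L\<^sub>x(w)\<close> for \<open>x \<noteq> a\<close>, the stated spins direct \<open>a s\<close>; conversely, the plain
  occurrences of \<open>a\<close> force every word in a directed sequence to begin with \<open>a\<close>, and removing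
  it leaves the \<open>L\<close>-expansion of \<open>s\<close>.
\<close>

subsection \<open>Justin's formula and left special factors\<close>

abbreviation L_app :: "'a \<Rightarrow> 'a list \<Rightarrow> 'a list" where
  "L_app x w \<equiv> concat (map (L_mor x) w)"

abbreviation R_app :: "'a \<Rightarrow> 'a list \<Rightarrow> 'a list" where
  "R_app x w \<equiv> concat (map (R_mor x) w)"

lemma L_mor_simps [simp]: "L_mor x x = [x]" "c \<noteq> x \<Longrightarrow> L_mor x c = [x, c]"
  by (simp_all add: L_mor_def)

lemma R_mor_simps [simp]: "R_mor x x = [x]" "c \<noteq> x \<Longrightarrow> R_mor x c = [c, x]"
  by (simp_all add: R_mor_def)

lemma R_mor_not_Nil [simp]: "R_mor x c \<noteq> []"
  by (simp add: R_mor_def)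

lemma L_mor_not_Nil [simp]: "L_mor x c \<noteq> []"
  by (simp add: L_mor_def)

lemma hd_R_mor [simp]: "hd (R_mor x c) = c"
  by (cases "c = x") simp_all

lemma hd_R_app [simp]: "w \<noteq> [] \<Longrightarrow> hd (R_app x w) = hd w"
  by (cases w) simp_all

text \<open>Each letter satisfies L_x(c) x = x R_x(c), so an \<open>x\<close> can be pushed from the
  right end of the image to the left, turning every block around.\<close>

lemma L_app_snoc: "L_app x w @ [x] = x # R_app x w"
proof (induction w)
  case (Cons c w)
  then show ?case by (cases "c = x") simp_all
qed simp

lemma L_app_append_Cons: "L_app x w @ x # r = x # R_app x w @ r"
  using arg_cong[OF L_app_snoc[of x w], of "\<lambda>u. u @ r"] by simp

lemma rev_L_app: "rev (L_app x w) = R_app x (rev w)"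
proof (induction w)
  case (Cons c w)
  then show ?case by (cases "c = x") simp_all
qed simp

lemma rev_R_app: "rev (R_app x w) = L_app x (rev w)"
proof (induction w)
  case (Cons c w)
  then show ?case by (cases "c = x") simp_all
qed simp

lemma rev_Cons_R_app: "rev (x # R_app x w) = x # R_app x (rev w)"
  by (simp add: rev_R_app L_app_snoc)

text \<open>Every block of \<open>R_mor x\<close> starts with the letter it encodes, so an image is
  decoded uniquely from left to right.\<close>

lemma R_app_inj: "R_app x u = R_app x v \<Longrightarrow> u = v"
proof (induction u arbitrary: v)
  case Nil
  then show ?case by (cases v) auto
next
  case (Cons c u)
  then obtain d v' where v: "v = d # v'" by (cases v) auto
  have "d = c"
    using hd_R_app[of "c # u" x] hd_R_app[of "d # v'" x] Cons.prems v
    by (metis list.sel(1) list.distinct(1))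
  with Cons v show ?case by simp
qed

text \<open>Every occurrence of \<open>x\<close> in \<open>x R\<^sub>x(w)\<close> ends a block.\<close>

lemma Cons_R_app_split:
  assumes "x # R_app x w = p @ x # q"
  obtains w1 w2 where "w = w1 @ w2" "p = L_app x w1" "q = R_app x w2"
  using assms
proof (induction w arbitrary: p thesis)
  case Nil
  then show ?case by (cases p) auto
next
  case (Cons c w)
  show ?case
  proof (cases p)
    case Nil
    with Cons.prems(1)[of "[]"] Cons.prems(2) show ?thesis by simp
  next
    case p: (Cons b p')
    show ?thesis
    proof (cases "c = x")
      case True
      with p Cons.prems(2) have "x # R_app x w = p' @ x # q" "b = x"
        by auto
      with Cons.IH obtain w1 w2 where "w = w1 @ w2" "p' = L_app x w1" "q = R_app x w2"
        by blast
      with True p \<open>b = x\<close> Cons.prems(1)[of "x # w1" w2] show ?thesis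
        by simp
    next
      case False
      with p Cons.prems(2) have bp: "b = x" "c # x # R_app x w = p' @ x # q" by auto
      with False obtain p'' where "p' = c # p''" "x # R_app x w = p'' @ x # q"
        by (metis append_eq_Cons_conv list.inject)
      with bp(1) have "b = x" "p' = c # p''" "x # R_app x w = p'' @ x # q" by blast+
      moreover from this Cons.IH obtain w1 w2
        where "w = w1 @ w2" "p'' = L_app x w1" "q = R_app x w2"
        by blast
      ultimately show ?thesis
        using False p Cons.prems(1)[of "c # w1" w2] by simp
    qed
  qed
qed

text \<open>Cutting before the \<open>x\<close> that follows \<open>z\<close> leaves
  \<open>p @ [z]\<close> as an L-image; blocks of \<open>L_mor x\<close> end with the letter they
  encode, so \<open>z\<close> is the last encoded letter.\<close>

lemma Cons_R_app_split_letter: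
  assumes "x # R_app x w = p @ z # x # q"
  obtains w1 w2 where "w = w1 @ z # w2" "q = R_app x w2"
proof -
  from assms have "x # R_app x w = (p @ [z]) @ x # q" by simp
  then obtain w1 w2 where w: "w = w1 @ w2" "p @ [z] = L_app x w1" "q = R_app x w2"
    by (rule Cons_R_app_split)
  then show ?thesis
  proof (cases w1 rule: rev_cases)
    case Nil
    with w show ?thesis by simp
  next
    case (snoc w1' c)
    with w have "z = c" by (cases "c = x") simp_all
    with snoc w that show ?thesis by simp
  qed
qed

text \<open>A letter other than \<open>x\<close> opens a block, and what precedes a block is either
  the leading \<open>x\<close> or the final \<open>x\<close> of the previous block.\<close>

lemma Cons_R_app_pred:
  assumes "x # R_app x w = p @ y # q" "y \<noteq> x"
  obtains p' where "p = p' @ [x]"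
  using assms
proof (induction w arbitrary: p thesis)
  case Nil
  then show ?case by (cases p) auto
next
  case (Cons c w)
  show ?case
  proof (cases "c = x")
    case True
    with Cons.prems(2,3) obtain p1 where "p = x # p1" "x # R_app x w = p1 @ y # q"
      by (cases p) auto
    with Cons.IH Cons.prems show ?thesis
      by (metis append_Cons)
  next
    case False
    with Cons.prems(2,3) obtain p1 where p1: "p = x # p1" "c # x # R_app x w = p1 @ y # q"
      by (cases p) auto
    show ?thesis
    proof (cases p1)
      case Nil
      with p1 Cons.prems(1)[of "[]"] show ?thesis by simp
    next
      case (Cons b p2)
      with p1 have "x # R_app x w = p2 @ y # q" by simp
      with Cons.IH Cons.prems(1,3) Cons p1 show ?thesis
        by (metis append_Cons)
    qed
  qed
qed

text \<open>The common prefix \<open>v\<close> may stop inside a block \<open>[c, x]\<close>. Its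
  letter \<open>c\<close> already fixes that block in both words, so a common \<open>v'\<close> is
  decoded whose image may run past \<open>v\<close> by \<open>r\<close>.\<close>

lemma R_app_common_prefix:
  assumes "R_app x w1 = v @ q1" "R_app x w2 = v @ q2"
  obtains v' r1 r2 r where "w1 = v' @ r1" "w2 = v' @ r2" "R_app x v' = v @ r"
  using assms
proof (induction w1 arbitrary: v w2 thesis)
  case Nil
  then show ?case by auto
next
  case (Cons c w1)
  show ?case
  proof (cases v)
    case Nil
    with Cons.prems(1)[of "[]"] show ?thesis by simp
  next
    case v: (Cons y r)
    with arg_cong[OF Cons.prems(2), of hd] have y: "y = c" by simp
    from v y arg_cong[OF Cons.prems(3), of hd] Cons.prems(3) obtain w2' where w2: "w2 = c # w2'"
      by (cases w2) auto
    show ?thesis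
    proof (cases "c = x")
      case True
      with v y w2 Cons.prems(2,3) have "R_app x w1 = r @ q1" "R_app x w2' = r @ q2"
        by simp_all
      with Cons.IH obtain v' r1 r2 r3 where "w1 = v' @ r1" "w2' = v' @ r2" "R_app x v' = r @ r3"
        by metis
      with True v y w2 Cons.prems(1)[of "c # v'" r1 r2 r3] show ?thesis
        by simp
    next
      case False
      show ?thesis
      proof (cases r)
        case Nil
        with False v y w2 Cons.prems(1)[of "[c]" w1 w2' "[x]"] show ?thesis
          by simp
      next
        case r: (Cons b r')
        with False v y w2 Cons.prems(2,3)
        have "R_app x w1 = r' @ q1" "R_app x w2' = r' @ q2" "b = x"
          by auto
        with Cons.IH obtain v' r1 r2 r3
          where "w1 = v' @ r1" "w2' = v' @ r2" "R_app x v' = r' @ r3"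
          by metis
        with False v y r \<open>b = x\<close> w2 Cons.prems(1)[of "c # v'" r1 r2 r3] show ?thesis
          by simp
      qed
    qed
  qed
qed

section \<open>Palindromic closure and its behaviour under the block morphisms\<close>

lemma pal_closure_props:
  "rev (pal_closure v) = pal_closure v \<and> (\<exists>z. pal_closure v = v @ z)"
  unfolding pal_closure_def
  by (rule arg_min_natI[where k = "v @ rev v"]) auto

lemma rev_pal_closure [simp]: "rev (pal_closure v) = pal_closure v"
  using pal_closure_props by blast

lemma pal_closure_prefix: obtains z where "pal_closure v = v @ z"
  using pal_closure_props by blast

lemma length_pal_closure_le: "rev p = p \<Longrightarrow> p = v @ z \<Longrightarrow> length (pal_closure v) \<le> length p"
  unfolding pal_closure_def by (rule arg_min_nat_le) auto

text \<open>Reversal puts \<open>rev z\<close> at the front of \<open>v\<close>. What remains of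
  \<open>v\<close> is the centre of the palindrome \<open>rev z @ b @ z\<close>, hence a
  palindrome.\<close>

lemma palindrome_overlap:
  assumes "rev (v @ z) = v @ z" "length z \<le> length v"
  obtains b where "v = rev z @ b" "rev b = b"
proof
  define b where "b = drop (length z) v"
  have eq: "rev z @ rev v = v @ z" using assms by simp
  have "take (length z) v = rev z"
    using arg_cong[OF eq, of "take (length z)"] assms(2) by simp
  then show v: "v = rev z @ b"
    by (metis append_take_drop_id b_def)
  show "rev b = b"
    using eq v
    by (metis append_assoc append_eq_append_conv length_rev rev_append rev_rev_ident same_append_eq)
qed

text \<open>\<open>a @ b @ rev a\<close> is a candidate, so the closure adds some \<open>z\<close>
  no longer than \<open>a\<close>. The overlap then exhibits a palindromic suffix whose complement
  is \<open>rev z\<close>, and minimality of \<open>a\<close> forces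
  \<open>rev z = a\<close>.\<close>

lemma pal_closure_eqI:
  assumes "rev b = b"
    and min: "\<And>a' b'. a @ b = a' @ b' \<Longrightarrow> rev b' = b' \<Longrightarrow> length a \<le> length a'"
  shows "pal_closure (a @ b) = a @ b @ rev a"
proof -
  let ?v = "a @ b"
  obtain z where z: "pal_closure ?v = ?v @ z" by (rule pal_closure_prefix)
  have le: "length (pal_closure ?v) \<le> length (?v @ rev a)"
    by (rule length_pal_closure_le[where z = "rev a"]) (use assms(1) in auto)
  then have "length z \<le> length a" using z by simp
  moreover have "rev (?v @ z) = ?v @ z" using rev_pal_closure[of ?v] z by simp
  ultimately obtain b' where b': "?v = rev z @ b'" "rev b' = b'"
    by (metis palindrome_overlap length_append trans_le_add1)
  from min[OF this] \<open>length z \<le> length a\<close> have "length (rev z) = length a" by simp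
  with b'(1) have "rev z = a" by (metis append_eq_append_conv)
  with z show ?thesis by auto
qed

lemma longest_palindromic_suffix:
  obtains a b where "v = a @ b" "rev b = b"
    "\<And>a' b'. v = a' @ b' \<Longrightarrow> rev b' = b' \<Longrightarrow> length a \<le> length a'"
proof -
  let ?P = "\<lambda>a. \<exists>b. v = a @ b \<and> rev b = b"
  have "?P v" by simp
  then have "?P (arg_min length ?P)" by (rule arg_min_natI)
  moreover have "\<And>a'. ?P a' \<Longrightarrow> length (arg_min length ?P) \<le> length a'"
    by (rule arg_min_nat_le)
  ultimately show thesis using that by blast
qed

text \<open>The map sending \<open>w\<close> to \<open>x # R_app x w\<close> preserves and reflects
  palindromes, so longest palindromic suffixes correspond and the closures do too. For
  \<open>y \<noteq> x\<close> the word to be closed lacks the final \<open>x\<close> of its last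
  block, so there the corresponding suffix loses its outer letters \<open>x\<close>.\<close>

lemma pal_closure_Cons_R_app:
  "pal_closure ((x # R_app x p) @ [y]) = x # R_app x (pal_closure (p @ [y]))"
proof -
  obtain a b where ab: "p @ [y] = a @ b" "rev b = b"
    and min: "\<And>a' b'. p @ [y] = a' @ b' \<Longrightarrow> rev b' = b' \<Longrightarrow> length a \<le> length a'"
    by (rule longest_palindromic_suffix[of "p @ [y]"]) blast
  have pc: "pal_closure (p @ [y]) = a @ b @ rev a"
    unfolding ab(1) by (rule pal_closure_eqI) (use ab min in auto)
  have "length a \<le> length p" using min[of p "[y]"] by simp
  with ab(1) have "b \<noteq> []" by auto
  \<comment> \<open>Lengths of images depend on the letters, not only on their number; the
    comparison works because \<open>a\<close> is a prefix of \<open>a'\<close>.\<close>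
  have L_le: "length (L_app x a) \<le> length (L_app x a')"
    if "p @ [y] = a' @ b'" "rev b' = b'" for a' b'
  proof -
    from min[OF that] ab(1) that(1) obtain c where "a' = a @ c"
      by (metis append_eq_append_conv_if append_take_drop_id)
    then show ?thesis by simp
  qed
  have pal: "rev b' = b'" if "rev (x # R_app x b') = x # R_app x b'" for b'
  proof (rule R_app_inj)
    show "R_app x (rev b') = R_app x b'"
      using that by (simp only: rev_Cons_R_app list.inject)
  qed
  show ?thesis
  proof (cases "y = x")
    case True
    have V: "(x # R_app x p) @ [y] = x # R_app x (p @ [y])" using True by simp
    have "pal_closure (L_app x a @ (x # R_app x b))
        = L_app x a @ (x # R_app x b) @ rev (L_app x a)"
    proof (rule pal_closure_eqI)
      show "rev (x # R_app x b) = x # R_app x b" by (simp only: rev_Cons_R_app ab(2))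
      fix a' b' assume eq: "L_app x a @ (x # R_app x b) = a' @ b'" and "rev b' = b'"
      have whole: "x # R_app x (p @ [y]) = a' @ b'"
        using eq by (simp add: ab(1) L_app_append_Cons)
      show "length (L_app x a) \<le> length a'"
      proof (cases b')
        case Nil
        then show ?thesis using arg_cong[OF eq, of length] by simp
      next
        case (Cons c b'')
        \<comment> \<open>A palindromic suffix starts with its last letter \<open>y = x\<close>, so
          the cut falls at an \<open>x\<close>, that is, at a block boundary.\<close>
        have "c = last b'" using Cons \<open>rev b' = b'\<close> by (metis last_rev list.sel(1))
        also have "\<dots> = y" using arg_cong[OF whole, of last] V Cons
          by (metis last_appendR last_snoc list.distinct(1))
        finally have "x # R_app x (p @ [y]) = a' @ x # b''"
          using whole True Cons by simp
        then obtain w1 w2 where w: "p @ [y] = w1 @ w2" "a' = L_app x w1" "b'' = R_app x w2"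
          by (rule Cons_R_app_split)
        have "rev w2 = w2"
          using pal \<open>rev b' = b'\<close> Cons w(3) \<open>c = last b'\<close> \<open>last b' = y\<close> True by metis
        from L_le[OF w(1) this] w(2) show ?thesis by simp
      qed
    qed
    moreover have "L_app x a @ (x # R_app x b) = (x # R_app x p) @ [y]"
      unfolding V ab(1) by (simp add: L_app_append_Cons)
    moreover have "L_app x a @ (x # R_app x b) @ rev (L_app x a) = x # R_app x (a @ b @ rev a)"
      by (simp add: rev_L_app L_app_append_Cons)
    ultimately show ?thesis by (simp only: pc)
  next
    case False
    have V: "(x # R_app x p) @ [y, x] = x # R_app x (p @ [y])" using False by simp
    from \<open>b \<noteq> []\<close> ab(1) have "last b = y" by (metis last_appendR last_snoc)
    then have "hd b = y" using \<open>rev b = b\<close> \<open>b \<noteq> []\<close> by (metis hd_rev)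
    then obtain b0 where b0: "b = y # b0" using \<open>b \<noteq> []\<close> by (cases b) auto
    \<comment> \<open>\<open>B\<close> is the image \<open>x # R_app x b\<close> without its outer
      letters \<open>x\<close>; it will be the longest palindromic suffix.\<close>
    define B where "B = y # L_app x b0"
    have LB: "L_app x b = x # B" using b0 False by (simp add: B_def)
    have Bx: "B @ [x] = R_app x b" using L_app_snoc[of x b] LB by simp
    have revB: "rev B = B"
    proof -
      have "rev (x # B @ [x]) = x # B @ [x]" unfolding Bx rev_Cons_R_app ab(2) by simp
      then show ?thesis by simp
    qed
    have Vab: "(L_app x a @ [x]) @ B = (x # R_app x p) @ [y]"
    proof -
      have "((L_app x a @ [x]) @ B) @ [x] = ((x # R_app x p) @ [y]) @ [x]"
        using V Bx by (simp add: ab(1) L_app_append_Cons)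
      then show ?thesis by simp
    qed
    have "pal_closure ((L_app x a @ [x]) @ B) = (L_app x a @ [x]) @ B @ rev (L_app x a @ [x])"
    proof (rule pal_closure_eqI)
      show "rev B = B" by (rule revB)
      fix a' b' assume eq: "(L_app x a @ [x]) @ B = a' @ b'" and "rev b' = b'"
      have whole: "x # R_app x (p @ [y]) = a' @ b' @ [x]"
        using eq Vab V by (metis append_assoc append_Cons append_Nil)
      show "length (L_app x a @ [x]) \<le> length a'"
      proof (cases b')
        case Nil
        then show ?thesis using arg_cong[OF eq, of length] by simp
      next
        case (Cons c b'')
        have "c = last b'" using Cons \<open>rev b' = b'\<close> by (metis last_rev list.sel(1))
        also have "\<dots> = y" using arg_cong[OF eq, of last] Vab Cons
          by (metis last_appendR last_snoc list.distinct(1))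
        finally have c: "c = y" .
        from whole Cons c have "x # R_app x (p @ [y]) = a' @ y # b'' @ [x]" by simp
        \<comment> \<open>The suffix \<open>b'\<close> starts with \<open>y \<noteq> x\<close>, so
          an \<open>x\<close> stands before it. Together with the appended final \<open>x\<close> it
          completes \<open>b'\<close> to an image that can be decoded.\<close>
        then obtain a1 where a1: "a' = a1 @ [x]" using False by (rule Cons_R_app_pred)
        with whole have "x # R_app x (p @ [y]) = a1 @ x # (b' @ [x])" by simp
        then obtain w1 w2 where w: "p @ [y] = w1 @ w2" "a1 = L_app x w1" "b' @ [x] = R_app x w2"
          by (rule Cons_R_app_split)
        have "rev (x # R_app x w2) = x # R_app x w2"
          unfolding w(3)[symmetric] using \<open>rev b' = b'\<close> by simp
        from L_le[OF w(1) pal[OF this]] w(2) a1 show ?thesis by simp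
      qed
    qed
    moreover have "(L_app x a @ [x]) @ B @ rev (L_app x a @ [x]) = x # R_app x (a @ b @ rev a)"
      using Bx by (simp add: rev_L_app rev_R_app L_app_append_Cons flip: Bx)
    ultimately show ?thesis by (simp only: pc Vab)
  qed
qed

text \<open>Justin's formula. The induction runs at the right end because \<open>Pal\<close> is a
  left fold, and the closure lemma carries the image across each new letter.\<close>

lemma Pal_Cons: "Pal (x # u) = x # R_app x (Pal u)"
proof (induction u rule: rev_induct)
  case Nil
  have "pal_closure ([] @ [x]) = [] @ [x] @ rev []"
    by (rule pal_closure_eqI) auto
  then show ?case using Pal_snoc[of "[]" x] by (simp add: Pal_Nil)
next
  case (snoc y u)
  have "Pal (x # u @ [y]) = pal_closure (Pal (x # u) @ [y])"
    using Pal_snoc[of "x # u" y] by simp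
  also have "\<dots> = x # R_app x (Pal (u @ [y]))"
    unfolding snoc.IH Pal_snoc by (rule pal_closure_Cons_R_app)
  finally show ?case .
qed

lemma Pal_palindrome [simp]: "rev (Pal u) = Pal u"
  by (cases u rule: rev_cases) (simp_all add: Pal_Nil Pal_snoc)

text \<open>Induction by decoding: one of \<open>z1\<close>, \<open>z2\<close> differs from
  \<open>x\<close> and is therefore followed by \<open>x\<close>, so a nonempty \<open>u\<close>
  starts with \<open>x\<close>. Both occurrences then decode to occurrences in \<open>Pal w\<close>
  of a common word \<open>v'\<close> preceded by \<open>z1\<close> and by \<open>z2\<close>.\<close>

lemma Pal_left_special_prefix:
  assumes "Pal w = p1 @ z1 # u @ q1" "Pal w = p2 @ z2 # u @ q2" "z1 \<noteq> z2"
  obtains q where "Pal w = u @ q"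
  using assms
proof (induction w arbitrary: p1 z1 p2 z2 u q1 q2 thesis)
  case Nil
  then show ?case by (simp add: Pal_Nil)
next
  case (Cons x w)
  show ?case
  proof (cases u)
    case Nil
    with Cons.prems(1) show ?thesis by simp
  next
    case u: (Cons c v)
    have c: "c = x" if "Pal (x # w) = p @ z # u @ q" "z \<noteq> x" for p z q
    proof (rule ccontr)
      assume "c \<noteq> x"
      from that u have "x # R_app x (Pal w) = (p @ [z]) @ c # v @ q" by (simp add: Pal_Cons)
      from Cons_R_app_pred[OF this \<open>c \<noteq> x\<close>] that(2) show False by auto
    qed
    have "c = x" using c Cons.prems(2-4) by metis
    with u Cons.prems(2,3)
    have "x # R_app x (Pal w) = p1 @ z1 # x # (v @ q1)"
      "x # R_app x (Pal w) = p2 @ z2 # x # (v @ q2)"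
      by (simp_all add: Pal_Cons)
    from Cons_R_app_split_letter[OF this(1)] Cons_R_app_split_letter[OF this(2)]
    obtain w1 w2 w1' w2' where w: "Pal w = w1 @ z1 # w2" "R_app x w2 = v @ q1"
        "Pal w = w1' @ z2 # w2'" "R_app x w2' = v @ q2"
      by metis
    obtain v' r1 r2 r where v': "w2 = v' @ r1" "w2' = v' @ r2" "R_app x v' = v @ r"
      by (rule R_app_common_prefix[OF w(2,4)])
    with w have "Pal w = w1 @ z1 # v' @ r1" "Pal w = w1' @ z2 # v' @ r2" by simp_all
    then obtain q where q: "Pal w = v' @ q"
      using Cons.IH Cons.prems(4) by metis
    show ?thesis
      by (rule Cons.prems(1)[of "r @ R_app x q"]) (simp add: Pal_Cons q v'(3) u \<open>c = x\<close>)
  qed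
qed

subsection \<open>Factors and morphic images of infinite words\<close>

lemma subsequence_of_prefix:
  assumes "prefix n w = p @ u @ q"
  shows "w [length p \<rightarrow> length p + length u] = u"
proof -
  have "u = take (length u) (drop (length p) (prefix n w))" by (simp add: assms)
  also have "\<dots> = subsequence w (length p) (min (length p + length u) n)" by simp
  finally show ?thesis using arg_cong[OF assms, of length] by simp
qed

lemma factors_iff_prefix: "u \<in> factors w \<longleftrightarrow> (\<exists>n p q. prefix n w = p @ u @ q)"
proof
  assume "u \<in> factors w"
  then obtain i j where "u = w [i \<rightarrow> j]" "i \<le> j" by (auto simp: factors_def)
  then have "prefix j w = prefix i w @ u @ []"
    using subsequence_append[of w i "j - i"] by simp
  then show "\<exists>n p q. prefix n w = p @ u @ q" by blast
next
  assume "\<exists>n p q. prefix n w = p @ u @ q"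
  then obtain n p q where eq: "prefix n w = p @ u @ q" by blast
  from subsequence_of_prefix[OF eq] show "u \<in> factors w"
    unfolding factors_def by (metis (mono_tags, lifting) le_add1 mem_Collect_eq)
qed

lemma prefix_in_factors [simp]: "prefix n w \<in> factors w"
  unfolding factors_def by blast

lemma factors_sublist: "p @ u @ q \<in> factors w \<Longrightarrow> u \<in> factors w"
  unfolding factors_iff_prefix by (metis append_assoc)

lemma factors_occurrence: "u \<in> factors w \<Longrightarrow> \<exists>i. w [i \<rightarrow> i + length u] = u"
  unfolding factors_iff_prefix using subsequence_of_prefix by blast

lemma prefix_Suc_build: "prefix (Suc n) (c ## w) = c # prefix n w"
  by (rule nth_equalityI) (auto simp: nth_Cons simp del: subseq_to_Suc split: nat.split)

lemma prefix_Suc_Cons: "prefix (Suc n) w = w 0 # prefix n (suffix 1 w)"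
  using prefix_Suc_build[of "w 0" "suffix 1 w" n] by (simp del: subseq_to_Suc)

lemma factors_subset_build: "factors w \<subseteq> factors (c ## w)"
proof
  fix u assume "u \<in> factors w"
  then obtain n p q where "prefix n w = p @ u @ q" unfolding factors_iff_prefix by blast
  then have "prefix (Suc n) (c ## w) = (c # p) @ u @ q"
    by (simp only: prefix_Suc_build append_Cons)
  then show "u \<in> factors (c ## w)" unfolding factors_iff_prefix by blast
qed

lemma factors_suffix_subset: "factors (suffix k w) \<subseteq> factors w"
  unfolding factors_def by (auto, metis add_le_cancel_left)

lemma episturmian_cong_factors:
  "factors v = factors w \<Longrightarrow> episturmian v \<longleftrightarrow> episturmian w"
  unfolding episturmian_def right_special_def by simp

text \<open>Occurrences in \<open>w\<close> shift by one; equality of the factor sets takes care of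
  factors that start at the new letter.\<close>

lemma recurrent_build:
  assumes "recurrent w" "factors (c ## w) = factors w"
  shows "recurrent (c ## w)"
  unfolding recurrent_def
proof
  fix u assume "u \<in> factors (c ## w)"
  with assms have inf: "infinite {i. w [i \<rightarrow> i + length u] = u}" by (simp add: recurrent_def)
  have "(c ## w) [Suc i \<rightarrow> Suc i + length u] = w [i \<rightarrow> i + length u]" for i
    by (rule nth_equalityI) (auto simp del: subseq_to_Suc)
  then have "Suc ` {i. w [i \<rightarrow> i + length u] = u}
      \<subseteq> {i. (c ## w) [i \<rightarrow> i + length u] = u}"
    by auto
  moreover from inf have "infinite (Suc ` {i. w [i \<rightarrow> i + length u] = u})"
    by (simp add: finite_image_iff)
  ultimately show "infinite {i. (c ## w) [i \<rightarrow> i + length u] = u}"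
    using finite_subset by blast
qed

lemma lex_less_asym: "lex_less u v \<Longrightarrow> \<not> lex_less v u"
  unfolding lex_less_def by (metis linorder_neqE_nat order_less_asym order_less_irrefl)

lemma periodic_eq_iter:
  assumes "\<And>i. w (i + k) = w i" "k > 0"
  shows "w = (prefix k w)\<^sup>\<omega>"
proof
  fix i
  have "w i = w (i mod k)"
  proof (induction i rule: less_induct)
    case (less i)
    show ?case
    proof (cases "i < k")
      case False
      then show ?thesis
        using assms(1)[of "i - k"] less[of "i - k"] \<open>k > 0\<close> by (simp add: le_mod_geq)
    qed simp
  qed
  then show "w i = (prefix k w)\<^sup>\<omega> i" using assms(2) by simp
qed

section \<open>Images of infinite words under non-erasing morphisms\<close>

lemma length_concat_map_ge: "(\<And>x. f x \<noteq> []) \<Longrightarrow> length w \<le> length (concat (map f w))"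
proof (induction w)
  case (Cons c w)
  then show ?case using Cons.prems[of c] by (cases "f c") auto
qed simp

text \<open>Images of longer prefixes extend those of shorter ones, so any prefix with a long enough
  image gives the same letter as the one in the definition.\<close>

lemma morph_image_nth:
  assumes "\<And>x. f x \<noteq> []" "k < length (concat (map f (prefix n w)))"
  shows "morph_image f w k = concat (map f (prefix n w)) ! k"
proof -
  have ext: "concat (map f (prefix n' w)) ! k = concat (map f (prefix m w)) ! k"
    if "m \<le> n'" "k < length (concat (map f (prefix m w)))" for m n'
  proof -
    have "prefix n' w = prefix m w @ w [m \<rightarrow> n']"
      using subsequence_append[of w m "n' - m"] that(1) by simp
    with that(2) show ?thesis by (simp add: nth_append)
  qed
  have "k < length (concat (map f (prefix (Suc k) w)))"
    using length_concat_map_ge[of f "prefix (Suc k) w"] assms(1)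
    by (simp del: subseq_to_Suc)
  with ext[of n "Suc k"] ext[of "Suc k" n] assms(2) show ?thesis
    unfolding morph_image_def by (metis nat_le_linear)
qed

lemma morph_image_conc:
  assumes "\<And>x. f x \<noteq> []"
  shows "morph_image f (u \<frown> w) = concat (map f u) \<frown> morph_image f w"
proof
  fix k
  let ?U = "concat (map f u)" and ?W = "concat (map f (prefix (Suc k) w))"
  have W: "k < length ?W"
    using length_concat_map_ge[of f "prefix (Suc k) w"] assms by (simp del: subseq_to_Suc)
  have "concat (map f (prefix (length u + Suc k) (u \<frown> w))) = ?U @ ?W"
    by (simp del: subseq_to_Suc add_Suc_right)
  with W morph_image_nth[of f k "u \<frown> w" "length u + Suc k"] assms
  have "morph_image f (u \<frown> w) k = (?U @ ?W) ! k" by simp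
  also have "\<dots> = (?U \<frown> morph_image f w) k"
    using W morph_image_nth[of f "k - length ?U" w "Suc k"] assms
    by (simp add: nth_append del: subseq_to_Suc)
  finally show "morph_image f (u \<frown> w) k = (?U \<frown> morph_image f w) k" .
qed

lemma morph_image_build:
  "(\<And>x. f x \<noteq> []) \<Longrightarrow> morph_image f (c ## w) = f c \<frown> morph_image f w"
  using morph_image_conc[of f "[c]" w] by simp

text \<open>The infinite form of L_x(w) x = x R_x(w), where the \<open>x\<close> at the right end
  disappears.\<close>

lemma morph_image_L_mor: "morph_image (L_mor x) w = x ## morph_image (R_mor x) w"
proof
  fix k
  show "morph_image (L_mor x) w k = (x ## morph_image (R_mor x) w) k"
  proof (cases k)
    case 0
    then show ?thesis by (simp add: morph_image_def L_mor_def)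
  next
    case (Suc j)
    let ?p = "prefix (Suc k) w"
    have L: "k < length (L_app x ?p)" and R: "j < length (R_app x ?p)"
      using length_concat_map_ge[of "L_mor x" ?p] length_concat_map_ge[of "R_mor x" ?p] Suc
      by (simp_all del: subseq_to_Suc)
    have "morph_image (L_mor x) w k = (L_app x ?p @ [x]) ! k"
      unfolding morph_image_def using L by (simp add: nth_append del: subseq_to_Suc)
    also have "\<dots> = R_app x ?p ! j" unfolding L_app_snoc Suc by simp
    also have "\<dots> = morph_image (R_mor x) w j"
      by (rule morph_image_nth[symmetric]) (use R in auto)
    finally show ?thesis using Suc by simp
  qed
qed

text \<open>For \<open>c \<noteq> x\<close> the first block is \<open>[c, x]\<close>, and its
  \<open>x\<close> turns the R-image of the rest into an L-image.\<close>

lemma morph_image_R_mor_build: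
  "morph_image (R_mor x) (c ## w) =
    (if c = x then x ## morph_image (R_mor x) w else c ## morph_image (L_mor x) w)"
  by (simp add: morph_image_build morph_image_L_mor)

lemma morph_image_L_mor_Pal:
  "morph_image (L_mor x) (Pal u \<frown> r) = Pal (x # u) \<frown> morph_image (R_mor x) r"
proof -
  have "morph_image (L_mor x) (Pal u \<frown> r)
      = L_app x (Pal u) \<frown> [x] \<frown> morph_image (R_mor x) r"
    by (simp add: morph_image_conc morph_image_L_mor[of x r] del: conc_conc)
  then show ?thesis unfolding conc_conc L_app_snoc Pal_Cons .
qed

subsection \<open>Epistandard words\<close>

lemma Pal_prefix_mono:
  assumes "m \<le> n"
  obtains z where "Pal (prefix n \<Delta>) = Pal (prefix m \<Delta>) @ z"
proof -
  from assms have "\<exists>z. Pal (prefix n \<Delta>) = Pal (prefix m \<Delta>) @ z"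
  proof (induction n rule: dec_induct)
    case (step n)
    obtain z where "pal_closure (Pal (prefix n \<Delta>) @ [\<Delta> n]) = (Pal (prefix n \<Delta>) @ [\<Delta> n]) @ z"
      by (rule pal_closure_prefix)
    with step.IH show ?case by (auto simp: Pal_snoc)
  qed simp
  with that show thesis by blast
qed

lemma Pal_prefix_Suc:
  obtains z where "Pal (prefix (Suc n) \<Delta>) = Pal (prefix n \<Delta>) @ \<Delta> n # z"
  using pal_closure_prefix[of "Pal (prefix n \<Delta>) @ [\<Delta> n]"] by (auto simp: Pal_snoc)

lemma length_Pal_ge: "length u \<le> length (Pal u)"
proof (induction u rule: rev_induct)
  case (snoc x u)
  obtain z where "pal_closure (Pal u @ [x]) = (Pal u @ [x]) @ z" by (rule pal_closure_prefix)
  with snoc show ?case by (simp add: Pal_snoc)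
qed simp

lemma length_Pal_prefix_ge: "n \<le> length (Pal (prefix n \<Delta>))"
  using length_Pal_ge[of "prefix n \<Delta>"] by simp

text \<open>The palindromes are nested and the one at index \<open>n\<close> has length at least
  \<open>n\<close>, so convergence to \<open>s\<close> amounts to each of them being a prefix of
  \<open>s\<close>.\<close>

lemma directive_word_of_iff:
  "directive_word_of \<Delta> s \<longleftrightarrow>
    (\<forall>n. prefix (length (Pal (prefix n \<Delta>))) s = Pal (prefix n \<Delta>))"
proof
  assume dir: "directive_word_of \<Delta> s"
  show "\<forall>n. prefix (length (Pal (prefix n \<Delta>))) s = Pal (prefix n \<Delta>)"
  proof
    fix n
    let ?k = "length (Pal (prefix n \<Delta>))"
    from dir obtain N where "\<And>m. m > N \<Longrightarrow> take ?k (Pal (prefix m \<Delta>)) = prefix ?k s"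
      unfolding directive_word_of_def word_limit_def MOST_nat by blast
    then have "take ?k (Pal (prefix (n + Suc N) \<Delta>)) = prefix ?k s"
      by (simp del: subseq_to_Suc add_Suc_right)
    moreover obtain z where "Pal (prefix (n + Suc N) \<Delta>) = Pal (prefix n \<Delta>) @ z"
      by (rule Pal_prefix_mono[of n "n + Suc N"]) simp
    ultimately show "prefix ?k s = Pal (prefix n \<Delta>)" by (simp del: subseq_to_Suc add_Suc_right)
  qed
next
  assume pre: "\<forall>n. prefix (length (Pal (prefix n \<Delta>))) s = Pal (prefix n \<Delta>)"
  show "directive_word_of \<Delta> s"
    unfolding directive_word_of_def word_limit_def MOST_nat
  proof (intro allI exI impI)
    fix k n :: nat assume "k < n"
    then have "k \<le> length (Pal (prefix n \<Delta>))" using length_Pal_prefix_ge[of n \<Delta>] by simp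
    then have "take k (prefix (length (Pal (prefix n \<Delta>))) s) = prefix k s" by simp
    then show "take k (Pal (prefix n \<Delta>)) = prefix k s" by (simp only: pre)
  qed
qed

lemma directive_word_ofI:
  assumes "\<And>n. \<exists>r. s = Pal (prefix n \<Delta>) \<frown> r"
  shows "directive_word_of \<Delta> s"
  unfolding directive_word_of_iff using assms by (metis prefix_conc_length)

lemma directive_word_of_conc:
  assumes "directive_word_of \<Delta> s"
  obtains r where "s = Pal (prefix n \<Delta>) \<frown> r"
  using assms prefix_suffix[of s "length (Pal (prefix n \<Delta>))"]
  unfolding directive_word_of_iff by metis

lemma directive_word_of_nth:
  assumes "directive_word_of \<Delta> s" "i < length (Pal (prefix n \<Delta>))"
  shows "s i = Pal (prefix n \<Delta>) ! i"
  using directive_word_of_conc[OF assms(1), of n] assms(2) by (metis conc_fst)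

lemma directed_word_unique:
  assumes "directive_word_of \<Delta> s" "directive_word_of \<Delta> s'"
  shows "s = s'"
proof
  fix i
  have "i < length (Pal (prefix (Suc i) \<Delta>))"
    using length_Pal_prefix_ge[of "Suc i" \<Delta>] by simp
  with assms show "s i = s' i" by (simp only: directive_word_of_nth)
qed

text \<open>In \<open>s\<close> the prefix \<open>Pal (prefix n D)\<close> is followed by
  \<open>D n\<close>, so \<open>s\<close> reveals its directive word letter by letter.\<close>

lemma directive_word_unique:
  assumes "directive_word_of \<Delta> s" "directive_word_of \<Delta>' s"
  shows "\<Delta> = \<Delta>'"
proof
  have letter: "D n = s (length (Pal (prefix n D)))" if D: "directive_word_of D s" for D n
  proof -
    obtain z where "Pal (prefix (Suc n) D) = Pal (prefix n D) @ D n # z"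
      by (rule Pal_prefix_Suc)
    then show ?thesis
      using directive_word_of_nth[OF D, of "length (Pal (prefix n D))" "Suc n"]
      by (simp add: nth_append del: subseq_to_Suc)
  qed
  have pre: "prefix n \<Delta> = prefix n \<Delta>'" for n
  proof (induction n)
    case (Suc n)
    have "\<Delta> n = \<Delta>' n" using letter[OF assms(1), of n] letter[OF assms(2), of n] Suc by simp
    with Suc show ?case by simp
  qed simp
  show "\<Delta> n = \<Delta>' n" for n
    using letter[OF assms(1), of n] letter[OF assms(2), of n] pre[of n] by simp
qed

lemma directive_word_of_exists: "\<exists>s. directive_word_of \<Delta> s"
proof
  \<comment> \<open>With \<open>Suc i\<close> the palindrome has more than \<open>i\<close> letters,
    so the index is in range.\<close>
  let ?s = "\<lambda>i. Pal (prefix (Suc i) \<Delta>) ! i"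
  show "directive_word_of \<Delta> ?s"
    unfolding directive_word_of_iff
  proof
    fix n
    show "prefix (length (Pal (prefix n \<Delta>))) ?s = Pal (prefix n \<Delta>)"
    proof (rule nth_equalityI)
      fix i assume "i < length (prefix (length (Pal (prefix n \<Delta>))) ?s)"
      then have i: "i < length (Pal (prefix n \<Delta>))" by simp
      have i': "i < length (Pal (prefix (Suc i) \<Delta>))"
        using length_Pal_prefix_ge[of "Suc i" \<Delta>] by simp
      have "Pal (prefix (Suc i) \<Delta>) ! i = Pal (prefix n \<Delta>) ! i"
      proof (cases "n \<le> Suc i")
        case True
        then obtain z where "Pal (prefix (Suc i) \<Delta>) = Pal (prefix n \<Delta>) @ z"
          by (rule Pal_prefix_mono)
        with i show ?thesis by (simp add: nth_append del: subseq_to_Suc)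
      next
        case False
        then obtain z where "Pal (prefix n \<Delta>) = Pal (prefix (Suc i) \<Delta>) @ z"
          using Pal_prefix_mono[of "Suc i" n \<Delta>] by (metis nat_le_linear)
        with i' show ?thesis by (simp add: nth_append del: subseq_to_Suc)
      qed
      with i show "prefix (length (Pal (prefix n \<Delta>))) ?s ! i = Pal (prefix n \<Delta>) ! i"
        by (simp del: subseq_to_Suc)
    qed simp
  qed
qed

lemma directive_word_of_L_mor:
  assumes "directive_word_of (suffix 1 \<Delta>) s"
  shows "directive_word_of \<Delta> (morph_image (L_mor (\<Delta> 0)) s)"
proof (rule directive_word_ofI)
  fix n
  show "\<exists>r. morph_image (L_mor (\<Delta> 0)) s = Pal (prefix n \<Delta>) \<frown> r"
  proof (cases n)
    case 0
    then show ?thesis by (simp add: Pal_Nil)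
  next
    case (Suc m)
    obtain r where "s = Pal (prefix m (suffix 1 \<Delta>)) \<frown> r"
      by (rule directive_word_of_conc[OF assms])
    then have "morph_image (L_mor (\<Delta> 0)) s = Pal (prefix n \<Delta>) \<frown> morph_image (R_mor (\<Delta> 0)) r"
      unfolding Suc prefix_Suc_Cons by (simp only: morph_image_L_mor_Pal)
    then show ?thesis by blast
  qed
qed

text \<open>Depth \<open>m + 1\<close> at level \<open>n\<close> uses depth \<open>m\<close> at
  level \<open>n + 1\<close>, so the induction covers all levels at once; each step is Justin's
  formula with a tail \<open>r\<close> attached.\<close>

lemma directive_word_of_L_mor_chain:
  assumes "\<And>n. T n = morph_image (L_mor (\<Delta> n)) (T (Suc n))"
  shows "directive_word_of \<Delta> (T 0)"
proof (rule directive_word_ofI)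
  have "\<exists>r. T n = Pal (prefix m (suffix n \<Delta>)) \<frown> r" for m n
  proof (induction m arbitrary: n)
    case 0
    then show ?case by (simp add: Pal_Nil)
  next
    case (Suc m)
    from Suc[of "Suc n"] obtain r where "T (Suc n) = Pal (prefix m (suffix (Suc n) \<Delta>)) \<frown> r"
      by blast
    then have "T n = Pal (\<Delta> n # prefix m (suffix (Suc n) \<Delta>)) \<frown> morph_image (R_mor (\<Delta> n)) r"
      using assms[of n] by (simp only: morph_image_L_mor_Pal)
    moreover have "prefix (Suc m) (suffix n \<Delta>) = \<Delta> n # prefix m (suffix (Suc n) \<Delta>)"
      unfolding prefix_Suc_Cons by simp
    ultimately show ?case by metis
  qed
  from this[where n = 0] show "\<exists>r. T 0 = Pal (prefix n \<Delta>) \<frown> r" for n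
    unfolding suffix_0 .
qed

section \<open>Factors, special factors and recurrence of epistandard words\<close>

lemma factors_directed_iff:
  assumes "directive_word_of \<Delta> s"
  shows "u \<in> factors s \<longleftrightarrow> (\<exists>n p q. Pal (prefix n \<Delta>) = p @ u @ q)"
proof
  assume "u \<in> factors s"
  then obtain n p q where eq: "prefix n s = p @ u @ q" unfolding factors_iff_prefix by blast
  let ?P = "Pal (prefix n \<Delta>)"
  have "?P = take n ?P @ drop n ?P" by simp
  also have "take n ?P = prefix n s"
    using assms length_Pal_prefix_ge[of n \<Delta>] unfolding directive_word_of_iff
    by (metis min.absorb1 subsequence_take add_0)
  finally show "\<exists>n p q. Pal (prefix n \<Delta>) = p @ u @ q" unfolding eq append_assoc by blast
next
  assume "\<exists>n p q. Pal (prefix n \<Delta>) = p @ u @ q"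
  with assms show "u \<in> factors s"
    unfolding factors_iff_prefix directive_word_of_iff by metis
qed

lemma rev_in_factors_directed:
  assumes "directive_word_of \<Delta> s" "u \<in> factors s"
  shows "rev u \<in> factors s"
proof -
  from assms obtain n p q where "Pal (prefix n \<Delta>) = p @ u @ q"
    by (auto simp: factors_directed_iff)
  then have "Pal (prefix n \<Delta>) = rev q @ rev u @ rev p"
    using Pal_palindrome[of "prefix n \<Delta>"] by simp
  with assms(1) show ?thesis by (auto simp: factors_directed_iff)
qed

text \<open>Reversal makes \<open>rev u\<close> left special. Both of its extensions lie in one
  palindromic prefix, of which \<open>rev u\<close> is then a prefix.\<close>

lemma right_special_directed:
  assumes dir: "directive_word_of \<Delta> s" and "right_special s u"
  shows "rev u = prefix (length u) s"
proof -
  from assms(2) obtain x y where "x \<noteq> y" "u @ [x] \<in> factors s" "u @ [y] \<in> factors s"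
    by (auto simp: right_special_def)
  then have "x # rev u \<in> factors s" "y # rev u \<in> factors s"
    using rev_in_factors_directed[OF dir] by fastforce+
  then obtain m1 p1 q1 m2 p2 q2
    where *: "Pal (prefix m1 \<Delta>) = p1 @ (x # rev u) @ q1"
      "Pal (prefix m2 \<Delta>) = p2 @ (y # rev u) @ q2"
    unfolding factors_directed_iff[OF dir] by blast
  define N where "N = max m1 m2"
  obtain z1 where z1: "Pal (prefix N \<Delta>) = Pal (prefix m1 \<Delta>) @ z1"
    by (rule Pal_prefix_mono[of m1 N]) (simp add: N_def)
  obtain z2 where z2: "Pal (prefix N \<Delta>) = Pal (prefix m2 \<Delta>) @ z2"
    by (rule Pal_prefix_mono[of m2 N]) (simp add: N_def)
  have "Pal (prefix N \<Delta>) = p1 @ x # rev u @ (q1 @ z1)" using z1 * by simp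
  moreover have "Pal (prefix N \<Delta>) = p2 @ y # rev u @ (q2 @ z2)" using z2 * by simp
  ultimately obtain q where q: "Pal (prefix N \<Delta>) = rev u @ q"
    using \<open>x \<noteq> y\<close> by (rule Pal_left_special_prefix)
  obtain r where "s = Pal (prefix N \<Delta>) \<frown> r" by (rule directive_word_of_conc[OF dir])
  with q have "s = rev u \<frown> (q \<frown> r)" by simp
  then show ?thesis by (metis length_rev prefix_conc_length)
qed

lemma episturmian_directed:
  assumes "directive_word_of \<Delta> s"
  shows "episturmian s"
  unfolding episturmian_def
  using rev_in_factors_directed[OF assms] right_special_directed[OF assms]
  by (metis rev_rev_ident)

lemma recurrent_directed:
  assumes "directive_word_of \<Delta> s"
  shows "recurrent s"
  unfolding recurrent_def
proof
  fix u assume "u \<in> factors s"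
  with assms obtain n p q where Pn: "Pal (prefix n \<Delta>) = p @ u @ q"
    by (auto simp: factors_directed_iff)
  show "infinite {i. s [i \<rightarrow> i + length u] = u}"
    unfolding infinite_nat_iff_unbounded_le
  proof
    fix m
    \<comment> \<open>This makes \<open>z\<close> at least \<open>m\<close> letters long. Reversing
      the longer palindrome moves the shorter one behind \<open>rev z\<close>, so \<open>u\<close>
      occurs at or after position \<open>m\<close>.\<close>
    define N where "N = m + n + length (Pal (prefix n \<Delta>))"
    obtain z where z: "Pal (prefix N \<Delta>) = Pal (prefix n \<Delta>) @ z"
      by (rule Pal_prefix_mono[of n N]) (simp add: N_def)
    have "m \<le> length z"
      using length_Pal_prefix_ge[of N \<Delta>] arg_cong[OF z, of length] by (simp add: N_def)
    have "Pal (prefix N \<Delta>) = rev z @ Pal (prefix n \<Delta>)"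
      using arg_cong[OF z, of rev] by simp
    then have "prefix (length (Pal (prefix N \<Delta>))) s = (rev z @ p) @ u @ q"
      using assms Pn unfolding directive_word_of_iff by (metis append_assoc)
    from subsequence_of_prefix[OF this] \<open>m \<le> length z\<close>
    show "\<exists>i\<ge>m. i \<in> {i. s [i \<rightarrow> i + length u] = u}"
      by (intro exI[of _ "length (rev z @ p)"]) simp
  qed
qed

subsection \<open>Strict epistandard words\<close>

text \<open>The directive word, hidden by an existential in \<open>strict_epistandard\<close>, is
  fixed here so that the arguments can refer to it.\<close>

locale strict_directive =
  fixes \<Delta> s :: "'a word"
  assumes directive: "directive_word_of \<Delta> s"
    and strict: "\<exists>\<^sub>\<infinity>i. \<Delta> i = x"
begin

text \<open>At a late position \<open>N\<close> with \<open>\<Delta> N = c\<close> the letter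
  \<open>c\<close> follows a palindromic prefix longer than \<open>m\<close>; reversing the next
  palindrome puts \<open>c\<close> in front of it.\<close>

lemma letter_prefix_in_factors: "c # prefix m s \<in> factors s"
proof -
  from strict[of c] obtain N where N: "N > m" "\<Delta> N = c" unfolding INFM_nat by blast
  obtain z where "Pal (prefix (Suc N) \<Delta>) = Pal (prefix N \<Delta>) @ c # z"
    using Pal_prefix_Suc[of \<Delta> N] N(2) by metis
  then have "rev (Pal (prefix (Suc N) \<Delta>)) = rev z @ c # Pal (prefix N \<Delta>)"
    by (simp del: Pal_palindrome add: Pal_palindrome[of "prefix N \<Delta>"])
  then have P: "Pal (prefix (Suc N) \<Delta>) = rev z @ c # Pal (prefix N \<Delta>)"
    by (simp only: Pal_palindrome)
  have "take m (Pal (prefix N \<Delta>)) = prefix m s"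
    using directive length_Pal_prefix_ge[of N \<Delta>] N(1) unfolding directive_word_of_iff
    by (metis min.absorb1 subsequence_take add_0 le_trans less_imp_le_nat)
  then have "Pal (prefix N \<Delta>) = prefix m s @ drop m (Pal (prefix N \<Delta>))"
    by (metis append_take_drop_id)
  with P have "Pal (prefix (Suc N) \<Delta>) = rev z @ (c # prefix m s) @ drop m (Pal (prefix N \<Delta>))"
    by simp
  then show ?thesis unfolding factors_directed_iff[OF directive] by blast
qed

lemma factors_build: "factors (c ## s) = factors s"
proof
  show "factors s \<subseteq> factors (c ## s)" by (rule factors_subset_build)
  show "factors (c ## s) \<subseteq> factors s"
  proof
    fix u assume "u \<in> factors (c ## s)"
    then obtain n p q where eq: "prefix n (c ## s) = p @ u @ q"
      unfolding factors_iff_prefix by blast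
    have "prefix n (c ## s) \<in> factors s"
    proof (cases n)
      case 0
      then show ?thesis using prefix_in_factors[of s 0] by simp
    next
      case (Suc m)
      then show ?thesis by (simp only: prefix_Suc_build letter_prefix_in_factors)
    qed
    with eq show "u \<in> factors s" by (metis factors_sublist)
  qed
qed

text \<open>Every letter can follow the palindromic prefix \<open>w\<close>. An eventual period no
  longer than \<open>w\<close> would let \<open>w\<close> determine the letter that follows
  it.\<close>

lemma aperiodic_directed:
  assumes "(c :: 'a) \<noteq> d"
  shows "aperiodic s"
  unfolding aperiodic_def
proof
  assume "\<exists>u v. v \<noteq> [] \<and> s = u \<frown> v\<^sup>\<omega>"
  then obtain u v where v: "v \<noteq> []" "s = u \<frown> v\<^sup>\<omega>" by blast
  have per: "s (i + length v) = s i" if "i \<ge> length u" for i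
  proof -
    have "s (i + length v) = v ! ((i + length v - length u) mod length v)"
      "s i = v ! ((i - length u) mod length v)"
      using v that by simp_all
    moreover have "i + length v - length u = i - length u + length v" using that by simp
    ultimately show ?thesis by simp
  qed
  define w where "w = Pal (prefix (length v) \<Delta>)"
  have len: "length v \<le> length w" unfolding w_def by (rule length_Pal_prefix_ge)
  have "rev w = w" by (simp add: w_def)
  have w: "w = prefix (length w) s"
    using directive unfolding directive_word_of_iff w_def by simp
  have det: "e = w ! (length w - length v)" for e
  proof -
    have "e # w \<in> factors s" using letter_prefix_in_factors[of e "length w"] w by simp
    then have "w @ [e] \<in> factors s"
      using rev_in_factors_directed[OF directive, of "e # w"] \<open>rev w = w\<close> by simp
    \<comment> \<open>Recurrence supplies an occurrence beyond the preperiod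
      \<open>u\<close>.\<close>
    then obtain i where i: "i > length u" "s [i \<rightarrow> i + length (w @ [e])] = w @ [e]"
      using recurrent_directed[OF directive]
      unfolding recurrent_def infinite_nat_iff_unbounded by blast
    have nth: "s (i + j) = (w @ [e]) ! j" if "j \<le> length w" for j
      using subsequence_nth[of j "i + length (w @ [e])" i s] i(2) that by simp
    have "e = s (i + length w)" using nth[of "length w"] by simp
    also have "\<dots> = s (i + (length w - length v))"
      using per[of "i + (length w - length v)"] i(1) len by simp
    also have "\<dots> = w ! (length w - length v)"
    proof -
      have "length v > 0" using v(1) by simp
      then have "length w - length v < length w" using len by linarith
      then show ?thesis using nth[of "length w - length v"] by (simp add: nth_append)
    qed
    finally show ?thesis .
  qed
  from det[of c] det[of d] assms show False by simp
qed

lemma suffix_build_neq: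
  assumes "(c :: 'a) \<noteq> d" "k > 0"
  shows "suffix k (a ## s) \<noteq> a ## s"
proof
  assume eq: "suffix k (a ## s) = a ## s"
  have "s (i + k) = s i" for i
    using fun_cong[OF eq, of "Suc i"] by (simp add: add.commute)
  then have "s = [] \<frown> (prefix k s)\<^sup>\<omega>" using periodic_eq_iter[of s k] assms(2) by simp
  moreover have "prefix k s \<noteq> []" using assms(2) by simp
  ultimately have "\<not> aperiodic s" unfolding aperiodic_def by metis
  with aperiodic_directed[OF assms(1)] show False by simp
qed

lemma build_first_difference:
  assumes "factors t \<subseteq> factors s" "(c :: 'a) \<noteq> d"
    and k: "\<forall>i<Suc k. (a ## s) i = t i" "s k \<noteq> t (Suc k)"
  shows "s k = a"
proof -
  define w x y where "w = prefix k s" and "x = s k" and "y = t (Suc k)"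
  have "prefix (Suc k) t = prefix (Suc k) (a ## s)"
    by (rule nth_equalityI) (use k(1) in \<open>auto simp del: subseq_to_Suc\<close>)
  also have "\<dots> = a # w" unfolding w_def by (rule prefix_Suc_build)
  finally have "prefix (Suc (Suc k)) t = a # w @ [y]"
    by (simp only: y_def subseq_to_Suc[of 0 "Suc k"] append_Cons zero_le)
  then have awy: "a # w @ [y] \<in> factors s" using assms(1) prefix_in_factors by (metis subsetD)
  \<comment> \<open>\<open>w @ [x]\<close> is a prefix of \<open>s\<close>, so every letter may
    precede it.\<close>
  have ewx: "e # w @ [x] \<in> factors s" for e
    using letter_prefix_in_factors[of e "Suc k"] by (simp add: w_def x_def)
  have rev_in: "rev u \<in> factors s" if "u \<in> factors s" for u
    using rev_in_factors_directed[OF directive that] .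
  have rs_unique: "u = v" if "right_special s u" "right_special s v" "length u = length v" for u v
    using episturmian_directed[OF directive] that unfolding episturmian_def by blast
  have "x \<noteq> y" using k(2) by (simp add: x_def y_def)
  \<comment> \<open>Both sides are right special of the same length: \<open>rev w\<close> since
    every letter precedes \<open>w\<close>, and \<open>w\<close> because of \<open>x\<close> and
    \<open>y\<close>.\<close>
  have "rev w = w"
  proof (rule rs_unique)
    have "rev w @ [e] \<in> factors s" for e
      using rev_in[OF letter_prefix_in_factors[of e k]] by (simp add: w_def)
    with assms(2) show "right_special s (rev w)" unfolding right_special_def by blast
    have "w @ [x] \<in> factors s" "w @ [y] \<in> factors s"
      using factors_sublist[of "[a]" "w @ [x]" "[]"] factors_sublist[of "[a]" "w @ [y]" "[]"]
        ewx[of a] awy by simp_all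
    with \<open>x \<noteq> y\<close> show "right_special s w" unfolding right_special_def by blast
  qed simp
  have "x # w = a # w"
  proof (rule rs_unique)
    \<comment> \<open>This is the reversal of \<open>y # w @ [x]\<close>, as \<open>w\<close> is a
      palindrome.\<close>
    have "x # w @ [y] \<in> factors s" using rev_in[OF ewx[of y]] \<open>rev w = w\<close> by simp
    with ewx[of x] \<open>x \<noteq> y\<close> show "right_special s (x # w)"
      unfolding right_special_def by (metis append_Cons)
    from ewx[of a] awy \<open>x \<noteq> y\<close> show "right_special s (a # w)"
      unfolding right_special_def by (metis append_Cons)
  qed simp
  then show ?thesis by (simp add: x_def)
qed

end

lemma strict_directive_suffix:
  assumes "\<And>x. \<exists>\<^sub>\<infinity>i. \<Delta> i = x" "directive_word_of (suffix k \<Delta>) s"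
  shows "strict_directive (suffix k \<Delta>) s"
proof
  fix x
  show "\<exists>\<^sub>\<infinity>i. suffix k \<Delta> i = x"
    unfolding INFM_nat
  proof
    fix m
    from assms(1)[of x] obtain n where "n > k + m" "\<Delta> n = x" unfolding INFM_nat by blast
    then show "\<exists>n>m. suffix k \<Delta> n = x" by (intro exI[of _ "n - k"]) auto
  qed
qed (rule assms(2))

lemma strict_epistandardE:
  assumes "strict_epistandard s"
  obtains \<Delta> where "strict_directive \<Delta> s"
  using assms unfolding strict_epistandard_def strict_directive_def by blast

section \<open>Lexicographic minimality and the Lyndon property\<close>

lemma two_letters:
  assumes "CARD('a::finite) > 1"
  obtains c d :: "'a::finite" where "c \<noteq> d"
  using assms by (metis One_nat_def card_le_Suc0_iff_eq finite not_le)

text \<open>At the first difference \<open>a ## s\<close> carries the least letter \<open>a\<close>: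
  trivially at position 0, and elsewhere by the uniqueness of right special factors.\<close>

lemma lex_less_build_strict:
  fixes a :: "'a::{finite,linorder}"
  assumes "CARD('a) > 1" "a = Min UNIV" "strict_directive \<Delta> s"
    and "factors t \<subseteq> factors s" "t \<noteq> a ## s"
  shows "lex_less (a ## s) t"
proof -
  interpret strict_directive \<Delta> s by fact
  have le: "a \<le> x" for x using assms(2) by simp
  obtain c d :: 'a where "c \<noteq> d"
    using assms(1) by (rule two_letters)
  define n where "n = (LEAST n. (a ## s) n \<noteq> t n)"
  have "\<exists>n. (a ## s) n \<noteq> t n" using assms(5) by (metis ext)
  then have n: "(a ## s) n \<noteq> t n" unfolding n_def by (rule LeastI_ex)
  have eq: "\<forall>i<n. (a ## s) i = t i" using not_less_Least n_def by blast
  have "(a ## s) n = a"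
  proof (cases n)
    case (Suc k)
    then show ?thesis
      using build_first_difference[OF assms(4) \<open>c \<noteq> d\<close>, of k a] eq n by simp
  qed simp
  with n le have "(a ## s) n < t n" by (simp add: order_less_le)
  with eq show ?thesis unfolding lex_less_def by blast
qed

lemma infinite_Lyndon_strict_iff:
  fixes a :: "'a::{finite,linorder}"
  assumes "CARD('a) > 1" "a = Min UNIV" "strict_episturmian t"
  shows "infinite_Lyndon t \<longleftrightarrow> (\<exists>s. strict_epistandard s \<and> t = a ## s)"
proof
  assume Lyndon: "infinite_Lyndon t"
  from assms(3) obtain s where s: "strict_epistandard s" "factors t = factors s"
    unfolding strict_episturmian_def by blast
  from s(1) obtain \<Delta> where sd: "strict_directive \<Delta> s" by (rule strict_epistandardE)
  have "t = a ## s"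
  proof (rule ccontr)
    assume "t \<noteq> a ## s"
    with lex_less_build_strict[OF assms(1,2) sd] s(2) have "lex_less (a ## s) t" by simp
    then obtain n where n: "\<forall>i<n. (a ## s) i = t i" "(a ## s) n < t n"
      unfolding lex_less_def by blast
    \<comment> \<open>The prefix of \<open>a ## s\<close> up to and including the first difference
      occurs in \<open>t\<close>; the suffix of \<open>t\<close> starting there is smaller than
      \<open>t\<close>.\<close>
    have "prefix (Suc n) (a ## s) \<in> factors t"
      using strict_directive.factors_build[OF sd] s(2) prefix_in_factors by metis
    from factors_occurrence[OF this] obtain i
      where i: "t [i \<rightarrow> i + Suc n] = prefix (Suc n) (a ## s)"
      by (auto simp del: subseq_to_Suc)
    have nth: "t (i + j) = (a ## s) j" if "j \<le> n" for j
      using arg_cong[OF i, of "\<lambda>u. u ! j"] that by (simp del: subseq_to_Suc add_Suc_right)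
    have less: "lex_less (suffix i t) t"
      unfolding lex_less_def using n nth by (intro exI[of _ n]) auto
    show False
    proof (cases "i = 0")
      case True
      with less lex_less_asym[OF less] show False by simp
    next
      case False
      with Lyndon lex_less_asym[OF less] show False unfolding infinite_Lyndon_def by blast
    qed
  qed
  with s(1) show "\<exists>s. strict_epistandard s \<and> t = a ## s" by blast
next
  assume "\<exists>s. strict_epistandard s \<and> t = a ## s"
  then obtain s where s: "strict_epistandard s" and t: "t = a ## s" by blast
  from s obtain \<Delta> where sd: "strict_directive \<Delta> s" by (rule strict_epistandardE)
  obtain c d :: 'a where "c \<noteq> d"
    using assms(1) by (rule two_letters)
  show "infinite_Lyndon t"
    unfolding infinite_Lyndon_def t
  proof (intro allI impI)
    fix k :: nat assume "k > 0"
    show "lex_less (a ## s) (suffix k (a ## s))"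
    proof (rule lex_less_build_strict[OF assms(1,2) sd])
      show "factors (suffix k (a ## s)) \<subseteq> factors s"
        using factors_suffix_subset strict_directive.factors_build[OF sd] by metis
      show "suffix k (a ## s) \<noteq> a ## s"
        by (rule strict_directive.suffix_build_neq[OF sd \<open>c \<noteq> d\<close> \<open>k > 0\<close>])
    qed
  qed
qed

subsection \<open>Spinned directive words\<close>

lemma mu_spin_build:
  "morph_image (mu (if x = a then Plain x else Barred x)) (a ## w) = a ## morph_image (L_mor x) w"
  by (cases "x = a") (simp_all add: morph_image_build[of "L_mor a"] morph_image_R_mor_build)

lemma directs_build:
  assumes "strict_directive \<Delta> s"
  shows "directs (\<lambda>i. if \<Delta> i = a then Plain (\<Delta> i) else Barred (\<Delta> i)) (a ## s)"
proof -
  interpret strict_directive \<Delta> s by fact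
  \<comment> \<open>\<open>S n\<close> is the epistandard word of the shifted directive word.
    Uniqueness links consecutive ones by L-morphisms, and prefixing \<open>a\<close> to each gives
    the directing sequence.\<close>
  obtain S where S: "\<And>n. directive_word_of (suffix n \<Delta>) (S n)"
    using choice[of "\<lambda>n. directive_word_of (suffix n \<Delta>)"] directive_word_of_exists by blast
  have "S 0 = s" using directed_word_unique[OF _ directive] S[of 0] by simp
  have "S n = morph_image (L_mor (\<Delta> n)) (S (Suc n))" for n
    using directive_word_of_L_mor[of "suffix n \<Delta>" "S (Suc n)"] S[of n] S[of "Suc n"]
    by (simp add: directed_word_unique)
  then have image: "a ## S n = morph_image (mu (if \<Delta> n = a then Plain (\<Delta> n) else Barred (\<Delta> n)))
      (a ## S (Suc n))" for n
    unfolding mu_spin_build by metis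
  have rec: "recurrent (a ## S n)" for n
    using recurrent_directed[OF S]
      strict_directive.factors_build[OF strict_directive_suffix[OF strict S]]
    by (rule recurrent_build)
  show ?thesis
    unfolding directs_def
  proof (intro exI[of _ "\<lambda>n. a ## S n"] conjI allI)
    show "a ## S 0 = a ## s" by (simp only: \<open>S 0 = s\<close>)
  qed (rule rec, rule image)
qed

lemma directs_imp_build:
  assumes "strict_directive \<Delta> s"
    and "directs (\<lambda>i. if \<Delta> i = a then Plain (\<Delta> i) else Barred (\<Delta> i)) u"
  shows "u = a ## s"
proof -
  interpret strict_directive \<Delta> s by fact
  from assms(2) obtain T where T0: "T 0 = u"
    and T: "\<And>n. T n = morph_image (mu (if \<Delta> n = a then Plain (\<Delta> n) else Barred (\<Delta> n))) (T (Suc n))"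
    unfolding directs_def by blast
  have plain: "T n 0 = a" if "\<Delta> n = a" for n
    using T[of n] that by (simp add: morph_image_L_mor)
  have barred: "T n 0 = T (Suc n) 0" if "\<Delta> n \<noteq> a" for n
  proof -
    have "T n = morph_image (R_mor (\<Delta> n)) (T (Suc n) 0 ## suffix 1 (T (Suc n)))"
      using T[of n] that by simp
    then show ?thesis unfolding morph_image_R_mor_build by simp
  qed
  \<comment> \<open>A letter with spin L equal to \<open>a\<close> forces the first letter
    \<open>a\<close>, and barred letters pass the first letter down; so the induction descends from
    the next occurrence of \<open>a\<close> in \<open>\<Delta>\<close>.\<close>
  have first: "T n 0 = a" for n
  proof -
    from strict[of a] obtain m where "m > n" "\<Delta> m = a" unfolding INFM_nat by blast
    then have "n \<le> m" by simp
    then show ?thesis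
    proof (induction n rule: inc_induct)
      case base
      show ?case using plain \<open>\<Delta> m = a\<close> .
    next
      case (step n)
      then show ?case using plain barred by metis
    qed
  qed
  define S where "S n = suffix 1 (T n)" for n
  have TS: "T n = a ## S n" for n
    unfolding S_def using build_split[of "T n"] first[of n] by simp
  \<comment> \<open>Cancelling the leading \<open>a\<close> turns either spin into the plain
    L-morphism, so the chain lemma applies.\<close>
  have "S n = morph_image (L_mor (\<Delta> n)) (S (Suc n))" for n
    using T[of n] unfolding TS mu_spin_build by simp
  then have "directive_word_of \<Delta> (S 0)" by (rule directive_word_of_L_mor_chain)
  then have "S 0 = s" using directive by (rule directed_word_unique)
  with TS[of 0] T0 show ?thesis by simp
qed

theorem theorem6p11:
  fixes a :: "'a::{finite,linorder}"
  assumes "CARD('a) > 1" and "a = Min UNIV"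
  shows "(\<forall>t. strict_episturmian t \<longrightarrow>
            (infinite_Lyndon t \<longleftrightarrow> (\<exists>s. strict_epistandard s \<and> t = a ## s))) \<and>
         (\<forall>s :: 'a word. strict_epistandard s \<longrightarrow> aperiodic s) \<and>
         (\<forall>s \<Delta>. strict_epistandard s \<and> directive_word_of \<Delta> s \<longrightarrow>
            (let b = (\<lambda>i. if \<Delta> i = a then Plain (\<Delta> i) else Barred (\<Delta> i)) in
               (episturmian (a ## s) \<and> factors (a ## s) = factors s \<and> directs b (a ## s)) \<and>
               (\<forall>u. episturmian u \<and> factors u = factors s \<and> directs b u \<longrightarrow> u = a ## s)))"
proof (intro conjI allI impI)
  show "infinite_Lyndon t \<longleftrightarrow> (\<exists>s. strict_epistandard s \<and> t = a ## s)"
    if "strict_episturmian t" for t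
    by (rule infinite_Lyndon_strict_iff[OF assms that])
next
  fix s :: "'a word" assume "strict_epistandard s"
  then obtain \<Delta> where "strict_directive \<Delta> s" by (rule strict_epistandardE)
  moreover obtain c d :: 'a where "c \<noteq> d"
    using assms(1) by (rule two_letters)
  ultimately show "aperiodic s" by (rule strict_directive.aperiodic_directed)
next
  fix s \<Delta> :: "'a word" assume s: "strict_epistandard s \<and> directive_word_of \<Delta> s"
  \<comment> \<open>Strictness is known for some directive word of \<open>s\<close>; uniqueness
    transfers it to the given \<open>\<Delta>\<close>.\<close>
  then obtain \<Delta>' where "strict_directive \<Delta>' s" by (auto elim: strict_epistandardE)
  moreover from this have "\<Delta>' = \<Delta>"
    using s directive_word_unique strict_directive.directive by blast
  ultimately have sd: "strict_directive \<Delta> s" by simp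
  note factors = strict_directive.factors_build[OF sd, of a]
  have "episturmian (a ## s)"
    using episturmian_directed s episturmian_cong_factors[OF factors] by blast
  with factors directs_build[OF sd] directs_imp_build[OF sd]
  show "let b = (\<lambda>i. if \<Delta> i = a then Plain (\<Delta> i) else Barred (\<Delta> i)) in
      (episturmian (a ## s) \<and> factors (a ## s) = factors s \<and> directs b (a ## s)) \<and>
      (\<forall>u. episturmian u \<and> factors u = factors s \<and> directs b u \<longrightarrow> u = a ## s)"
    unfolding Let_def by blast
qed

end
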